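(* Let $1\le r\le m$ and $n\ge1$ be integers, let $h>0$, $t_j=t_0+jh$ for $j=0,\ldots,n$, and let $\mathcal{Y}_0,\ldots,\mathcal{Y}_n\in\mathrm{Gr}(r,m)$ be data at these nodes. Assume that all $\mathrm{GLERP}$ evaluations in the recursive construction of $\mathrm{GIDER}_n(\mathcal{Y}_0,\ldots,\mathcal{Y}_n;t)$, $t\in[t_0,t_n]$, are well-defined. Then $$\mathrm{GIDER}_n(\mathcal{Y}_0,\ldots,\mathcal{Y}_n;t_j)=\mathcal{Y}_j,\qquad j=0,1,\ldots,n.$$
   Context: $\mathrm{Gr}(r,m)$ is the Grassmann manifold of $r$-dimensional linear subspaces of $\mathbb{R}^m$. A point $\mathcal{Y}$ is represented by $Y\in\mathbb{R}^{m\times r}$ with $Y^TY=I_r$ and $\mathcal{Y}=\mathrm{span}(Y)$ (column span); $Y$ and $YR$, $R\in O(r)$, represent the same point. The tangent space is identified with $\{\Delta\in\mathbb{R}^{m\times r}:Y^T\Delta=0\}$, with the canonical Riemannian metric $\langle\Delta_1,\Delta_2\rangle=\mathrm{tr}(\Delta_1^T\Delta_2)$. The principal angles $\theta_1,\ldots,\theta_r\in[0,\pi/2]$ between $\mathrm{span}(Y_0)$ and $\mathrm{span}(Y_1)$ are defined by the requirement that $\cos\theta_j$ are the singular values of $Y_0^TY_1$. Exponential map: if $\Delta=U\Theta V^T$ is a thin SVD ($V\in O(r)$), then $\mathrm{Exp}_{\mathcal{Y}}(\Delta)=\mathrm{span}(YV\cos\Theta+U\sin\Theta)$. Logarithm map: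 when all principal angles between $\mathcal{Y}_0=\mathrm{span}(Y_0)$ and $\mathcal{Y}_1=\mathrm{span}(Y_1)$ are $<\pi/2$ (equivalently $Y_0^TY_1$ is invertible), $\mathrm{Log}_{\mathcal{Y}_0}(\mathcal{Y}_1)=U\arctan(\Sigma)V^T$, where $Y_1(Y_0^TY_1)^{-1}-Y_0=U\Sigma V^T$ is an SVD. $\mathrm{GLERP}(\mathcal{A},\mathcal{B};\lambda)=\mathrm{Exp}_{\mathcal{A}}\bigl(\lambda\,\mathrm{Log}_{\mathcal{A}}(\mathcal{B})\bigr)$, used for all real $\lambda$ (including $\lambda\notin[0,1]$); the evaluation is well-defined when the logarithm is uniquely defined, i.e. all principal angles between $\mathcal{A}$ and $\mathcal{B}$ are $<\pi/2$. $\mathrm{GIDER}_n$: set $\mathcal{I}_j^0(t)=\mathcal{Y}_j$ and for $k=1,\ldots,n$, $j=0,\ldots,n-k$, $$\mathcal{I}_j^k(t)=\mathrm{GLERP}\bigl(\mathcal{I}_j^{k-1}(t),\mathcal{I}_{j+1}^{k-1}(t);\lambda_j^k(t)\bigr),\qquad \lambda_j^k(t)=\frac{t-t_j}{t_{j+k}-t_j}.$$ Then $\mathrm{GIDER}_n(\mathcal{Y}_0,\ldots,\mathcal{Y}_n;t)=\mathcal{I}_0^n(t)$ for $t\in[t_0,t_n]$. *)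

theory Defs
  imports "HOL-Analysis.Analysis"
begin

text \<open>
  The dimensions are types: \<open>m = CARD('m)\<close>, \<open>r = CARD('r)\<close>, and an \<open>m\<close> by \<open>r\<close> matrix has type
  \<open>real^'r^'m\<close>. Points of the Grassmann manifold are the subspaces themselves; functions on
  them whose type does not determine \<open>'r\<close> take an argument \<open>TYPE('r)\<close>.
\<close>

definition grassmannian :: "'r::finite itself \<Rightarrow> (real^'m) set set" where
  "grassmannian _ = {S. subspace S \<and> dim S = CARD('r)}"

definition col_span :: "real^'r^'m \<Rightarrow> (real^'m) set" where
  "col_span Y = span (columns Y)"

definition represents :: "real^'r^'m \<Rightarrow> (real^'m) set \<Rightarrow> bool" where
  "represents Y S \<longleftrightarrow> transpose Y ** Y = mat 1 \<and> col_span Y = S"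

definition diag_mat :: "('r \<Rightarrow> real) \<Rightarrow> real^'r^'r" where
  "diag_mat d = (\<chi> i j. if i = j then d i else 0)"

text \<open>
  The singular values are indexed by \<open>'r\<close> and carry no order. If some of them vanish, the
  corresponding columns of \<open>U\<close> are arbitrary up to orthonormality. For a square matrix
  (\<open>'m = 'r\<close>) this is the full singular value decomposition.
\<close>

definition thin_svd ::
  "real^'r^'m \<Rightarrow> real^'r^'m \<Rightarrow> ('r \<Rightarrow> real) \<Rightarrow> real^'r^'r \<Rightarrow> bool" where
  "thin_svd M U s V \<longleftrightarrow>
     transpose U ** U = mat 1 \<and> orthogonal_matrix V \<and> (\<forall>i. 0 \<le> s i) \<and>
     M = U ** diag_mat s ** transpose V"

definition principal_angles ::
  "(real^'m) set \<Rightarrow> (real^'m) set \<Rightarrow> ('r::finite \<Rightarrow> real) \<Rightarrow> bool" where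
  "principal_angles A B \<theta> \<longleftrightarrow>
     (\<forall>j. 0 \<le> \<theta> j \<and> \<theta> j \<le> pi / 2) \<and>
     (\<exists>(Y0 :: real^'r^'m) (Y1 :: real^'r^'m) P Q. represents Y0 A \<and> represents Y1 B \<and>
        thin_svd (transpose Y0 ** Y1) P (\<lambda>j. cos (\<theta> j)) Q)"

text \<open>
  The angles exist for any two points and are unique up to order, so the existential
  quantifier over \<open>\<theta>\<close> amounts to speaking of the principal angles.
\<close>

definition glerp_well_defined ::
  "'r::finite itself \<Rightarrow> (real^'m) set \<Rightarrow> (real^'m) set \<Rightarrow> bool" where
  "glerp_well_defined _ A B \<longleftrightarrow>
     (\<exists>\<theta> :: 'r \<Rightarrow> real. principal_angles A B \<theta> \<and> (\<forall>j. \<theta> j < pi / 2))"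

text \<open>
  Tangent vectors at \<open>span Y\<close> are matrices \<open>\<Delta>\<close> with \<open>Y\<^sup>T \<Delta> = 0\<close>. This identification depends
  on \<open>Y\<close>, so both maps below are relative to a representative \<open>Y\<close> of the base point. The
  descriptions express independence of the chosen decomposition, and in \<open>gr_log\<close> also of
  the representative of \<open>B\<close>.
\<close>

definition gr_exp :: "real^'r^'m \<Rightarrow> real^'r^'m \<Rightarrow> (real^'m) set" where
  "gr_exp Y \<Delta> = (THE C. \<exists>U \<theta> V. thin_svd \<Delta> U \<theta> V \<and>
     C = col_span (Y ** V ** diag_mat (\<lambda>i. cos (\<theta> i)) + U ** diag_mat (\<lambda>i. sin (\<theta> i))))"

definition gr_log :: "real^'r^'m \<Rightarrow> (real^'m) set \<Rightarrow> real^'r^'m" where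
  "gr_log Y B = (THE \<Delta>. \<exists>(Y1 :: real^'r^'m) U \<sigma> V. represents Y1 B \<and>
     thin_svd (Y1 ** matrix_inv (transpose Y ** Y1) - Y) U \<sigma> V \<and>
     \<Delta> = U ** diag_mat (\<lambda>i. arctan (\<sigma> i)) ** transpose V)"

text \<open>
  Replacing \<open>Y\<close> by \<open>Y ** R\<close> with \<open>R\<close> orthogonal replaces the logarithm by its product with
  \<open>R\<close> and leaves the exponential of the result unchanged.
\<close>

definition glerp ::
  "'r::finite itself \<Rightarrow> (real^'m) set \<Rightarrow> (real^'m) set \<Rightarrow> real \<Rightarrow> (real^'m) set" where
  "glerp _ A B \<mu> = (THE C. \<exists>Y :: real^'r^'m. represents Y A \<and>
     C = gr_exp Y (\<mu> *\<^sub>R gr_log Y B))"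

text \<open>\<open>gider_step T t Y s k j\<close> is the intermediate point with upper index \<open>k\<close> and lower index
  \<open>j\<close> at parameter \<open>s\<close>, for nodes \<open>t\<close> and data \<open>Y\<close>.\<close>

primrec gider_step ::
  "'r::finite itself \<Rightarrow> (nat \<Rightarrow> real) \<Rightarrow> (nat \<Rightarrow> (real^'m) set) \<Rightarrow> real \<Rightarrow> nat \<Rightarrow> nat \<Rightarrow> (real^'m) set"
where
  "gider_step T t Y s 0 = (\<lambda>j. Y j)"
| "gider_step T t Y s (Suc k) =
     (\<lambda>j. glerp T (gider_step T t Y s k j) (gider_step T t Y s k (Suc j))
            ((s - t j) / (t (j + Suc k) - t j)))"

definition gider ::
  "'r::finite itself \<Rightarrow> nat \<Rightarrow> (nat \<Rightarrow> real) \<Rightarrow> (nat \<Rightarrow> (real^'m) set) \<Rightarrow> real \<Rightarrow> (real^'m) set" where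
  "gider T n t Y s = gider_step T t Y s n 0"

definition gider_well_defined ::
  "'r::finite itself \<Rightarrow> nat \<Rightarrow> (nat \<Rightarrow> real) \<Rightarrow> (nat \<Rightarrow> (real^'m) set) \<Rightarrow> real \<Rightarrow> bool" where
  "gider_well_defined T n t Y s \<longleftrightarrow>
     (\<forall>k\<in>{1..n}. \<forall>j\<in>{0..n-k}.
        glerp_well_defined T (gider_step T t Y s (k - 1) j) (gider_step T t Y s (k - 1) (j + 1)))"

end

(*
  At a node t_i every intermediate point whose data indices j, ..., j + k include i equals Y_i,
  by induction on k: the interpolation parameter is 0 if i = j, it is 1 if i = j + k, and
  otherwise both arguments of GLERP are already Y_i. It remains to evaluate GLERP at 0, at 1 and
  for equal arguments. At 1 one needs Exp (Log B) = B: if Y1 (Y^T Y1)^-1 - Y = U S V^T, then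
  Y V cos (arctan S) + U sin (arctan S) = (Y V + U S) cos (arctan S)
  = Y1 (Y^T Y1)^-1 V cos (arctan S), whose columns span B. Exp and Log are definite descriptions
  over all thin singular value decompositions, so existence of a decomposition and independence
  of its choice are also needed.
*)

theory Submission
  imports Defs
begin

section \<open>Column spans and orthonormal columns\<close>

lemma col_span_eq_range:
  fixes Y :: "real^'r^'m"
  shows "col_span Y = range ((*v) Y)"
proof
  have "columns Y \<subseteq> range ((*v) Y)"
    by (auto simp: columns_image_basis)
  moreover have "subspace (range ((*v) Y))"
    by (intro linear_subspace_image matrix_vector_mul_linear subspace_UNIV)
  ultimately show "col_span Y \<subseteq> range ((*v) Y)"
    unfolding col_span_def by (rule span_minimal)
  show "range ((*v) Y) \<subseteq> col_span Y"
    unfolding col_span_def using matrix_vector_mult_in_columnspace by blast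
qed

text \<open>An invertible right factor only reparametrises the range. Every later change of
  representative or of decomposition is absorbed this way.\<close>

lemma col_span_mult_invertible:
  fixes Y :: "real^'r^'m" and R :: "real^'r^'r"
  assumes "invertible R"
  shows "col_span (Y ** R) = col_span Y"
proof -
  obtain R' where R': "R ** R' = mat 1"
    using assms by (auto simp: invertible_def)
  have "Y *v x \<in> range ((*v) (Y ** R))" for x
    by (rule range_eqI[where x = "R' *v x"])
      (metis R' matrix_mul_assoc matrix_mul_rid matrix_vector_mul_assoc)
  moreover have "(Y ** R) *v x \<in> range ((*v) Y)" for x
    by (metis matrix_vector_mul_assoc rangeI)
  ultimately show ?thesis
    unfolding col_span_eq_range by blast
qed

lemma orthogonal_matrix_invertible:
  fixes R :: "real^'r^'r"
  shows "orthogonal_matrix R \<Longrightarrow> invertible R"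
  by (auto simp: orthogonal_matrix_def invertible_def)

lemma matrix_inv_inverse:
  fixes A :: "real^'r^'r"
  assumes "invertible A"
  shows "A ** matrix_inv A = mat 1" and "matrix_inv A ** A = mat 1"
  using someI_ex[OF assms[unfolded invertible_def]] by (simp_all add: matrix_inv_def)

lemma matrix_inv_unique:
  fixes A B :: "real^'r^'r"
  assumes "A ** B = mat 1"
  shows "B = matrix_inv A"
  by (metis assms invertible_right_inverse matrix_inv_inverse(2) matrix_mul_assoc matrix_mul_lid matrix_mul_rid)

lemma matrix_add_rdistrib:
  fixes A B :: "real^'n^'m" and C :: "real^'p^'n"
  shows "(A + B) ** C = A ** C + B ** C"
  by (simp add: matrix_matrix_mult_def vec_eq_iff sum.distrib distrib_right)

lemma gram_matrix_eq_mat_1_iff: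
  fixes U :: "real^'r^'m"
  shows "transpose U ** U = mat 1 \<longleftrightarrow>
    (\<forall>i j. column i U \<bullet> column j U = (if i = j then 1 else 0))"
  by (simp add: vec_eq_iff matrix_matrix_mult_def transpose_def mat_def column_def inner_vec_def)

text \<open>The transition matrix has to be \<open>transpose Y ** Z\<close>. It is orthogonal
  because \<open>Y ** transpose Y\<close> projects onto \<open>S\<close>, where the columns of
  \<open>Z\<close> lie.\<close>

lemma represents_change_basis:
  fixes Y Z :: "real^'r^'m"
  assumes Y: "represents Y S" and Z: "represents Z S"
  obtains R where "orthogonal_matrix R" "Z = Y ** R"
proof
  let ?R = "transpose Y ** Z"
  have YY: "transpose Y ** Y = mat 1" and ZZ: "transpose Z ** Z = mat 1"
    and sp: "range ((*v) Z) = range ((*v) Y)"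
    using assms by (auto simp: represents_def col_span_eq_range)
  \<comment> \<open>\<open>Y ** transpose Y\<close> fixes every vector \<open>Y *v z\<close>, and
    \<open>Z *v x\<close> is of this form.\<close>
  have "(Y ** ?R) *v x = Z *v x" for x
  proof -
    obtain z where z: "Z *v x = Y *v z"
      using sp by (metis imageE rangeI)
    have "(Y ** ?R) *v x = Y *v (transpose Y *v (Z *v x))"
      by (simp only: matrix_vector_mul_assoc)
    also have "\<dots> = Y *v ((transpose Y ** Y) *v z)"
      by (simp only: z matrix_vector_mul_assoc)
    finally show ?thesis
      by (simp add: YY z)
  qed
  then show eq: "Z = Y ** ?R"
    by (metis matrix_eq)
  have "transpose ?R ** ?R = transpose Z ** (Y ** ?R)"
    by (simp add: matrix_transpose_mul matrix_mul_assoc)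
  also have "\<dots> = mat 1"
    using eq ZZ by simp
  finally show "orthogonal_matrix ?R"
    by (simp add: orthogonal_matrix)
qed

text \<open>Orthonormal bases are obtained as sets, while the columns of a matrix need an indexing
  by the type \<open>'r\<close>.\<close>

lemma orthonormal_set_family:
  fixes B :: "'a::real_inner set"
  assumes "finite B" "card B = CARD('r::finite)" "pairwise orthogonal B" "\<And>b. b \<in> B \<Longrightarrow> norm b = 1"
  obtains p :: "'r::finite \<Rightarrow> 'a" where "range p = B" "\<And>i j. p i \<bullet> p j = (if i = j then 1 else 0)"
proof -
  obtain p where p: "bij_betw p (UNIV :: 'r set) B"
    using assms(1,2) by (metis finite finite_same_card_bij)
  have "p i \<bullet> p j = (if i = j then 1 else 0)" for i j
  proof (cases "i = j")
    case True
    then show ?thesis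
      using assms(4)[of "p i"] bij_betwE[OF p] by (simp add: norm_eq_1)
  next
    case False
    then have "p i \<noteq> p j"
      using bij_betw_imp_inj_on[OF p] by (simp add: inj_eq)
    then show ?thesis
      using False assms(3) bij_betwE[OF p] by (simp add: pairwise_def orthogonal_def)
  qed
  then show thesis
    using p by (intro that[of p]) (auto simp: bij_betw_def)
qed

lemma grassmannian_represents:
  fixes S :: "(real^'m) set"
  assumes "S \<in> grassmannian TYPE('r::finite)"
  obtains Y :: "real^'r^'m" where "represents Y S"
proof -
  have S: "subspace S" "dim S = CARD('r)"
    using assms by (auto simp: grassmannian_def)
  obtain B where B: "pairwise orthogonal B" "\<And>x. x \<in> B \<Longrightarrow> norm x = 1"
    "independent B" "card B = dim S" "span B = S"
    using orthonormal_basis_subspace[OF S(1)] by metis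
  have "finite B"
    using B(3) by (rule independent_imp_finite)
  moreover have "card B = CARD('r)"
    using B(4) S(2) by simp
  ultimately obtain p :: "'r \<Rightarrow> real^'m" where p: "range p = B"
    "\<And>i j. p i \<bullet> p j = (if i = j then 1 else 0)"
    using orthonormal_set_family[of B] B(1,2) by blast
  define Y :: "real^'r^'m" where "Y = (\<chi> i j. p j $ i)"
  have col: "column j Y = p j" for j
    by (simp add: Y_def column_def vec_eq_iff)
  have "columns Y = B"
    using p(1) by (auto simp: columns_def col)
  then have "represents Y S"
    by (simp add: represents_def col_span_def gram_matrix_eq_mat_1_iff col p(2) B(5))
  then show thesis
    by (rule that)
qed

section \<open>Existence of thin singular value decompositions\<close>

text \<open>A maximiser of the Rayleigh quotient on an invariant subspace is an eigenvector.\<close>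

lemma symmetric_eigenvector:
  fixes f :: "'a::euclidean_space \<Rightarrow> 'a"
  assumes f: "linear f" and sym: "\<And>x y. f x \<bullet> y = x \<bullet> f y"
    and S: "subspace S" and inv: "f ` S \<subseteq> S" and "dim S \<noteq> 0"
  obtains v c where "v \<in> S" "norm v = 1" "f v = c *\<^sub>R v"
proof -
  let ?K = "S \<inter> sphere 0 1"
  have "compact ?K"
    by (simp add: S closed_subspace closed_Int_compact)
  moreover have "?K \<noteq> {}"
  proof -
    obtain x where x: "x \<in> S" "x \<noteq> 0"
      using \<open>dim S \<noteq> 0\<close> by (metis dim_eq_0 singletonI subsetI)
    have "x /\<^sub>R norm x \<in> ?K"
      using x S by (simp add: subspace_scale)
    then show ?thesis by blast
  qed
  moreover have "continuous_on ?K (\<lambda>x. x \<bullet> f x)"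
    using f by (intro continuous_intros linear_continuous_on) (simp add: linear_linear)
  ultimately obtain v where v: "v \<in> ?K" and max: "\<And>x. x \<in> ?K \<Longrightarrow> x \<bullet> f x \<le> v \<bullet> f v"
    using continuous_attains_sup by metis
  define c where "c = v \<bullet> f v"
  \<comment> \<open>\<open>w\<close> is the part of \<open>f v\<close> orthogonal to
    \<open>v\<close>; the eigenvector equation amounts to \<open>w = 0\<close>.\<close>
  define w where "w = f v - c *\<^sub>R v"
  have nv: "v \<bullet> v = 1" "v \<in> S"
    using v by (auto simp: norm_eq_1)
  have quad: "x \<bullet> f x \<le> c * (x \<bullet> x)" if "x \<in> S" for x
  proof (cases "x = 0")
    case True
    then show ?thesis using f by (simp add: linear_0)
  next
    case False
    have "(x /\<^sub>R norm x) \<bullet> f (x /\<^sub>R norm x) \<le> c"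
      unfolding c_def using that S False by (intro max) (simp add: subspace_scale)
    then show ?thesis
      using False by (simp add: linear_cmul[OF f] field_simps power2_norm_eq_inner[symmetric] power2_eq_square)
  qed
  have "w \<in> S"
    using nv(2) inv S by (auto simp: w_def intro: subspace_diff subspace_scale)
  \<comment> \<open>Perturb the maximiser to \<open>v + e *\<^sub>R w\<close> and expand
    \<open>quad\<close>: the constant terms cancel, and the coefficient of \<open>e\<close> is twice
    \<open>w \<bullet> w\<close>.\<close>
  have first_order: "2 * e * (w \<bullet> w) + e\<^sup>2 * (w \<bullet> f w - c * (w \<bullet> w)) \<le> 0" for e
  proof -
    have "v + e *\<^sub>R w \<in> S"
      using nv(2) \<open>w \<in> S\<close> S by (simp add: subspace_add subspace_scale)
    from quad[OF this] have le: "(v + e *\<^sub>R w) \<bullet> f (v + e *\<^sub>R w) \<le> c * ((v + e *\<^sub>R w) \<bullet> (v + e *\<^sub>R w))" .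
    have 1: "(v + e *\<^sub>R w) \<bullet> f (v + e *\<^sub>R w) = c + 2 * e * (w \<bullet> f v) + e\<^sup>2 * (w \<bullet> f w)"
      using sym[of v w]
      by (simp add: linear_add[OF f] linear_cmul[OF f] algebra_simps power2_eq_square c_def inner_commute)
    have 2: "(v + e *\<^sub>R w) \<bullet> (v + e *\<^sub>R w) = 1 + 2 * e * (w \<bullet> v) + e\<^sup>2 * (w \<bullet> w)"
      by (simp add: algebra_simps power2_eq_square nv(1) inner_commute)
    have 3: "w \<bullet> w = w \<bullet> f v - c * (w \<bullet> v)"
      by (simp add: w_def inner_diff_right)
    show ?thesis
      using le unfolding 1 2 using arg_cong[OF 3, of "\<lambda>x. 2 * e * x"] by (simp add: algebra_simps)
  qed
  have "w \<bullet> w = 0"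
  proof (rule ccontr)
    assume "w \<bullet> w \<noteq> 0"
    then have pos: "w \<bullet> w > 0" by simp
    define a where "a = w \<bullet> w"
    \<comment> \<open>\<open>b\<close> dominates the coefficient of the quadratic term, and the
      added 1 makes it positive. For \<open>e = a / b\<close> the linear term is
      \<open>2 * a\<^sup>2 / b\<close>, while the quadratic term is at least
      \<open>- a\<^sup>2 / b\<close>, so the sum is positive.\<close>
    define b where "b = \<bar>w \<bullet> f w - c * (w \<bullet> w)\<bar> + 1"
    have ab: "a > 0" "b > 0" using pos by (auto simp: a_def b_def)
    have "2 * (a / b) * a + (a / b)\<^sup>2 * (w \<bullet> f w - c * (w \<bullet> w)) \<le> 0"
      using first_order[of "a / b"] by (simp add: a_def)
    moreover have "(a / b)\<^sup>2 * (- b) \<le> (a / b)\<^sup>2 * (w \<bullet> f w - c * (w \<bullet> w))"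
      by (intro mult_left_mono) (auto simp: b_def)
    moreover have "(a / b)\<^sup>2 * (- b) = - (a / b * a)"
      using ab by (simp add: power2_eq_square)
    moreover have "a / b * a > 0"
      using ab by simp
    ultimately show False by linarith
  qed
  then have "f v = c *\<^sub>R v"
    by (simp add: w_def)
  with v show thesis
    by (intro that[of v c]) auto
qed

text \<open>Induction on the dimension: split off a unit eigenvector \<open>v\<close> and recurse
  into its orthogonal complement within \<open>S\<close>. By symmetry \<open>f\<close> maps this
  complement to itself.\<close>

lemma symmetric_eigenbasis:
  fixes f :: "'a::euclidean_space \<Rightarrow> 'a"
  assumes f: "linear f" and sym: "\<And>x y. f x \<bullet> y = x \<bullet> f y"
    and S: "subspace S" and inv: "f ` S \<subseteq> S"
  shows "\<exists>B\<subseteq>S. finite B \<and> card B = dim S \<and> pairwise orthogonal B \<and>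
           (\<forall>b\<in>B. norm b = 1 \<and> (\<exists>c. f b = c *\<^sub>R b))"
  using S inv
proof (induction "dim S" arbitrary: S)
  case 0
  then show ?case by (intro exI[of _ "{}"]) auto
next
  case (Suc d)
  obtain v c where v: "v \<in> S" "norm v = 1" "f v = c *\<^sub>R v"
    using symmetric_eigenvector[OF f sym Suc.prems] Suc.hyps(2) by (metis Zero_not_Suc)
  let ?T = "{y \<in> S. \<forall>x\<in>span {v}. orthogonal x y}"
  have T_iff: "y \<in> ?T \<longleftrightarrow> y \<in> S \<and> v \<bullet> y = 0" for y
    by (auto simp: span_singleton orthogonal_def)
  have "dim ?T + dim (span {v}) = dim S"
    using v Suc.prems by (intro dim_subspace_orthogonal_to_vectors span_minimal) auto
  moreover have "dim (span {v}) = 1"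
    using v by (auto simp: dim_insert)
  ultimately have d: "d = dim ?T"
    using Suc.hyps(2) by simp
  have sub: "subspace ?T"
    using Suc.prems(1) by (auto simp: subspace_def T_iff orthogonal_clauses)
  have "f ` ?T \<subseteq> ?T"
  proof
    fix z assume "z \<in> f ` ?T"
    then obtain y where y: "y \<in> S" "v \<bullet> y = 0" "z = f y"
      using T_iff by auto
    have "v \<bullet> f y = 0"
      using sym[of v y] v(3) y(2) by simp
    then show "z \<in> ?T"
      using y Suc.prems(2) T_iff by auto
  qed
  from Suc.hyps(1)[OF d sub this] obtain B where B: "B \<subseteq> ?T" "finite B" "card B = d"
    "pairwise orthogonal B" "\<forall>b\<in>B. norm b = 1 \<and> (\<exists>c. f b = c *\<^sub>R b)"
    using d by auto
  have vB: "v \<bullet> b = 0" if "b \<in> B" for b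
    using B(1) that T_iff by blast
  have "v \<notin> B"
    using vB[of v] v(2) by (auto simp: norm_eq_1)
  then have "card (insert v B) = dim S"
    using B(2,3) Suc.hyps(2) by simp
  moreover have "pairwise orthogonal (insert v B)"
    using B(4) vB by (auto simp: pairwise_insert orthogonal_def inner_commute)
  ultimately show ?case
    using B v by (intro exI[of _ "insert v B"]) auto
qed

text \<open>Supplies the columns of \<open>U\<close> that belong to vanishing singular values. The
  orthogonal complement of the given vectors has dimension at least
  \<open>CARD('r) - card J\<close>, so an orthonormal basis of it has enough elements for the
  missing indices.\<close>

lemma orthonormal_family_extend:
  fixes u :: "'r::finite \<Rightarrow> 'a::euclidean_space"
  assumes orth: "\<And>i j. i \<in> J \<Longrightarrow> j \<in> J \<Longrightarrow> u i \<bullet> u j = (if i = j then 1 else 0)"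
    and card: "CARD('r) \<le> DIM('a)"
  obtains w where "\<And>i. i \<in> J \<Longrightarrow> w i = u i"
    and "\<And>i j. w i \<bullet> w j = (if i = j then 1 else 0)"
proof -
  let ?C = "u ` J" let ?D = "{y \<in> UNIV. \<forall>x\<in>span ?C. orthogonal x y}"
  have "dim ?D + dim (span ?C) = DIM('a)"
    using dim_subspace_orthogonal_to_vectors[of "span ?C" UNIV] by simp
  moreover have "dim (span ?C) \<le> card J"
    by (metis card_image_le dim_le_card' dim_span finite finite_imageI order_trans)
  moreover have "card J + card (- J) = CARD('r)"
    by (metis card_Un_disjoint Compl_disjoint Compl_partition finite)
  ultimately have le: "card (- J) \<le> dim ?D"
    using card by linarith
  have "subspace ?D"
    using subspace_orthogonal_to_vectors[of "span ?C"] by simp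
  then obtain B where B: "B \<subseteq> ?D" "pairwise orthogonal B" "\<And>x. x \<in> B \<Longrightarrow> norm x = 1"
    "independent B" "card B = dim ?D" "span B = ?D"
    by (rule orthonormal_basis_subspace) (rule that)
  then obtain q where q: "q ` (- J) \<subseteq> B" "inj_on q (- J)"
    using card_le_inj[of "- J" B] le independent_imp_finite[OF B(4)] by auto
  define w where "w i = (if i \<in> J then u i else q i)" for i
  have uq: "u i \<bullet> q j = 0" if "i \<in> J" "j \<notin> J" for i j
  proof -
    have "q j \<in> ?D" using q(1) B(1) that by auto
    then show ?thesis using that(1) by (auto simp: orthogonal_def span_base)
  qed
  have qq: "q i \<bullet> q j = (if i = j then 1 else 0)" if "i \<notin> J" "j \<notin> J" for i j
  proof (cases "i = j")
    case True
    then show ?thesis using B(3)[of "q i"] q(1) that by (auto simp: norm_eq_1)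
  next
    case False
    then have "q i \<noteq> q j" using q(2) that by (auto simp: inj_on_def)
    then show ?thesis using B(2) q(1) that False by (auto simp: pairwise_def orthogonal_def)
  qed
  have "w i \<bullet> w j = (if i = j then 1 else 0)" for i j
    using orth[of i j] uq[of i j] uq[of j i] qq[of i j]
    by (auto simp: w_def inner_commute)
  then show thesis
    by (intro that[of w]) (auto simp: w_def)
qed

section \<open>Products and inverses of diagonal matrices\<close>

lemma transpose_diag_mat [simp]: "transpose (diag_mat d) = diag_mat d"
  by (auto simp: diag_mat_def transpose_def vec_eq_iff)

lemma diag_mat_1: "diag_mat (\<lambda>_. 1) = mat 1"
  by (simp add: diag_mat_def mat_def)

lemma diag_mat_0: "diag_mat (\<lambda>_. 0) = 0"
  by (simp add: diag_mat_def vec_eq_iff)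

lemma matrix_diag_mat_nth: "(M ** diag_mat d) $ i $ j = M $ i $ j * d j"
  by (simp add: diag_mat_def matrix_matrix_mult_def mult_delta_right)

lemma diag_mat_matrix_nth: "(diag_mat d ** M) $ i $ j = d i * M $ i $ j"
  by (simp add: diag_mat_def matrix_matrix_mult_def mult_delta_left)

lemma diag_mat_mult: "diag_mat a ** diag_mat b = diag_mat (\<lambda>i. a i * b i)"
  by (simp add: vec_eq_iff matrix_diag_mat_nth) (simp add: diag_mat_def)

lemma invertible_diag_mat:
  assumes "\<And>i. d i \<noteq> 0"
  shows "invertible (diag_mat d)"
proof -
  have "diag_mat d ** diag_mat (\<lambda>i. inverse (d i)) = mat 1"
    using assms by (simp add: diag_mat_mult diag_mat_1)
  then show ?thesis
    by (auto simp: invertible_right_inverse)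
qed

text \<open>Diagonalise \<open>transpose M ** M\<close>. Its orthonormal eigenvectors are the
  columns of \<open>V\<close>; their images under \<open>M\<close> are pairwise orthogonal, the
  lengths of the images are the singular values, and the normalised images are columns of
  \<open>U\<close>.\<close>

lemma thin_svd_exists:
  fixes M :: "real^'r^'m"
  assumes "CARD('r) \<le> CARD('m)"
  obtains U s V where "thin_svd M U s V"
proof -
  define f where "f x = transpose M *v (M *v x)" for x
  have f_inner: "x \<bullet> f y = (M *v x) \<bullet> (M *v y)" for x y
    using dot_lmul_matrix[of "M *v y" M x] by (simp add: f_def inner_commute)
  have "linear f"
    unfolding f_def by (simp only: matrix_vector_mul_assoc matrix_vector_mul_linear)
  moreover have "f x \<bullet> y = x \<bullet> f y" for x y
    by (metis f_inner inner_commute)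
  ultimately obtain B where B: "finite B" "card B = CARD('r)" "pairwise orthogonal B"
    "\<forall>b\<in>B. norm b = 1 \<and> (\<exists>c. f b = c *\<^sub>R b)"
    using symmetric_eigenbasis[of f UNIV] by auto
  then obtain p :: "'r \<Rightarrow> real^'r" where p: "range p = B"
    and pp: "\<And>i j. p i \<bullet> p j = (if i = j then 1 else 0)"
    using orthonormal_set_family[of B] by blast
  have Mp: "(M *v p i) \<bullet> (M *v p j) = 0" if "i \<noteq> j" for i j
  proof -
    obtain c where "f (p j) = c *\<^sub>R p j" using B(4) p by blast
    then show ?thesis using f_inner[of "p i" "p j"] pp[of i j] that by simp
  qed
  define s where "s j = norm (M *v p j)" for j
  \<comment> \<open>Only images of nonzero length can be normalised; the other columns of
    \<open>U\<close> come from extending the orthonormal family.\<close>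
  define J where "J = {j. s j \<noteq> 0}"
  have "((M *v p i) /\<^sub>R s i) \<bullet> ((M *v p j) /\<^sub>R s j) = (if i = j then 1 else 0)"
    if "i \<in> J" "j \<in> J" for i j
    using that Mp[of i j]
    by (auto simp: J_def s_def field_simps simp flip: power2_norm_eq_inner power2_eq_square)
  then obtain w where w: "\<And>i. i \<in> J \<Longrightarrow> w i = (M *v p i) /\<^sub>R s i"
    "\<And>i j. w i \<bullet> w j = (if i = j then 1 else 0)"
    using orthonormal_family_extend[of J "\<lambda>i. (M *v p i) /\<^sub>R s i"] assms by auto
  define V :: "real^'r^'r" where "V = (\<chi> i j. p j $ i)"
  define U :: "real^'r^'m" where "U = (\<chi> i j. w j $ i)"
  have colV: "column j V = p j" and colU: "column j U = w j" for j
    by (simp_all add: V_def U_def column_def vec_eq_iff)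
  have UU: "transpose U ** U = mat 1"
    by (simp add: gram_matrix_eq_mat_1_iff colU w(2))
  have V: "orthogonal_matrix V"
    by (simp add: orthogonal_matrix gram_matrix_eq_mat_1_iff colV pp)
  \<comment> \<open>Outside \<open>J\<close> both sides vanish, whatever column was chosen
    there.\<close>
  have Mw: "M *v p j = s j *\<^sub>R w j" for j
    using w(1)[of j] by (cases "j \<in> J") (auto simp: J_def s_def)
  have "(M ** V) $ i $ j = (M *v p j) $ i" for i j
    by (simp add: V_def matrix_matrix_mult_def matrix_vector_mult_def)
  then have "M ** V = U ** diag_mat s"
    by (simp add: vec_eq_iff matrix_diag_mat_nth Mw U_def mult.commute)
  then have "M = U ** diag_mat s ** transpose V"
    using V by (metis matrix_mul_assoc matrix_mul_rid orthogonal_matrix_def)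
  then show thesis
    using UU V by (intro that[of U s V]) (simp add: thin_svd_def s_def)
qed

section \<open>Functions of singular values\<close>

text \<open>With \<open>W = V'\<^sup>T V\<close>, the hypothesis says \<open>W\<^sub>i\<^sub>j a\<^sub>j = b\<^sub>i W\<^sub>i\<^sub>j\<close>; where \<open>W\<^sub>i\<^sub>j \<noteq> 0\<close>
  this gives \<open>a\<^sub>j = b\<^sub>i\<close>, so \<open>f\<close> may be applied to both.\<close>

lemma spectral_function_unique:
  fixes V V' :: "real^'r^'r"
  assumes V: "orthogonal_matrix V" and V': "orthogonal_matrix V'"
    and eq: "V ** diag_mat a ** transpose V = V' ** diag_mat b ** transpose V'"
  shows "V ** diag_mat (\<lambda>i. f (a i)) ** transpose V = V' ** diag_mat (\<lambda>i. f (b i)) ** transpose V'"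
proof -
  let ?W = "transpose V' ** V"
  note [simp] = V[unfolded orthogonal_matrix_def] V'[unfolded orthogonal_matrix_def]
  have "?W ** diag_mat a = transpose V' ** (V ** diag_mat a ** transpose V) ** V"
    by (simp flip: matrix_mul_assoc)
  also have "\<dots> = (transpose V' ** V') ** diag_mat b ** ?W"
    unfolding eq by (simp only: matrix_mul_assoc)
  finally have "?W ** diag_mat a = diag_mat b ** ?W"
    by simp
  then have entry: "?W $ i $ j * a j = b i * ?W $ i $ j" for i j
    by (metis diag_mat_matrix_nth matrix_diag_mat_nth)
  have "?W $ i $ j * f (a j) = f (b i) * ?W $ i $ j" for i j
    using entry[of i j] by (cases "?W $ i $ j = 0") (auto simp: mult.commute)
  then have W: "?W ** diag_mat (\<lambda>i. f (a i)) = diag_mat (\<lambda>i. f (b i)) ** ?W"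
    by (simp add: vec_eq_iff diag_mat_matrix_nth matrix_diag_mat_nth)
  have "V ** diag_mat (\<lambda>i. f (a i)) ** transpose V
      = (V' ** transpose V') ** V ** diag_mat (\<lambda>i. f (a i)) ** transpose V"
    by simp
  also have "\<dots> = V' ** (?W ** diag_mat (\<lambda>i. f (a i))) ** transpose V"
    by (simp only: matrix_mul_assoc)
  also have "\<dots> = V' ** diag_mat (\<lambda>i. f (b i)) ** transpose V' ** (V ** transpose V)"
    unfolding W by (simp only: matrix_mul_assoc)
  finally show ?thesis
    by simp
qed

text \<open>The Gram matrix \<open>transpose M ** M\<close> equals \<open>V\<close> times the
  squared singular values times \<open>transpose V\<close>, with no trace of \<open>U\<close>, so
  uniqueness of spectral functions applies to it. Nonnegativity recovers the singular values as
  square roots.\<close>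

lemma thin_svd_right_function:
  fixes M :: "real^'r^'m"
  assumes "thin_svd M U s V" and "thin_svd M U' s' V'"
  shows "V ** diag_mat (\<lambda>i. f (s i)) ** transpose V = V' ** diag_mat (\<lambda>i. f (s' i)) ** transpose V'"
proof -
  have gram: "transpose M ** M = V ** diag_mat (\<lambda>i. (s i)\<^sup>2) ** transpose V"
    if "thin_svd M U s V" for U s V
  proof -
    have UU: "transpose U ** U = mat 1" and M: "M = U ** diag_mat s ** transpose V"
      using that by (auto simp: thin_svd_def)
    have "transpose M ** M = V ** diag_mat s ** (transpose U ** U) ** diag_mat s ** transpose V"
      unfolding M by (simp add: matrix_transpose_mul matrix_mul_assoc)
    also have "\<dots> = V ** (diag_mat s ** diag_mat s) ** transpose V"
      by (simp add: UU matrix_mul_assoc)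
    finally show ?thesis
      by (simp add: diag_mat_mult power2_eq_square)
  qed
  have "V ** diag_mat (\<lambda>i. f (sqrt ((s i)\<^sup>2))) ** transpose V
      = V' ** diag_mat (\<lambda>i. f (sqrt ((s' i)\<^sup>2))) ** transpose V'"
    using assms gram[OF assms(1)] gram[OF assms(2)]
    by (intro spectral_function_unique[where f = "\<lambda>x. f (sqrt x)"]) (auto simp: thin_svd_def)
  then show ?thesis
    using assms by (simp add: thin_svd_def)
qed

text \<open>Writing \<open>f x = x * g x\<close> turns \<open>U f(\<Sigma>) V\<^sup>T\<close> into \<open>M V g(\<Sigma>) V\<^sup>T\<close>, which no longer involves \<open>U\<close>.\<close>

lemma thin_svd_left_function:
  fixes M :: "real^'r^'m"
  assumes "thin_svd M U s V" and "thin_svd M U' s' V'" and "f 0 = (0::real)"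
  shows "U ** diag_mat (\<lambda>i. f (s i)) ** transpose V = U' ** diag_mat (\<lambda>i. f (s' i)) ** transpose V'"
proof -
  have *: "U ** diag_mat (\<lambda>i. f (s i)) ** transpose V
      = M ** (V ** diag_mat (\<lambda>i. f (s i) / s i) ** transpose V)"
    if "thin_svd M U s V" for U s V
  proof -
    have VV: "transpose V ** V = mat 1" and M: "M = U ** diag_mat s ** transpose V"
      using that by (auto simp: thin_svd_def orthogonal_matrix_def)
    have "M ** (V ** diag_mat (\<lambda>i. f (s i) / s i) ** transpose V)
      = U ** diag_mat s ** (transpose V ** V) ** diag_mat (\<lambda>i. f (s i) / s i) ** transpose V"
      unfolding M by (simp only: matrix_mul_assoc)
    also have "\<dots> = U ** (diag_mat s ** diag_mat (\<lambda>i. f (s i) / s i)) ** transpose V"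
      by (simp add: VV matrix_mul_assoc)
    also have "diag_mat s ** diag_mat (\<lambda>i. f (s i) / s i) = diag_mat (\<lambda>i. f (s i))"
    proof -
      \<comment> \<open>At \<open>s i = 0\<close> the quotient is 0 by convention, and
        \<open>f 0 = 0\<close> makes the two sides agree.\<close>
      have "s i * (f (s i) / s i) = f (s i)" for i
        using assms(3) by (cases "s i = 0") auto
      then show ?thesis by (simp only: diag_mat_mult)
    qed
    finally show ?thesis by simp
  qed
  show ?thesis
    using *[OF assms(1)] *[OF assms(2)] thin_svd_right_function[OF assms(1,2), of "\<lambda>x. f x / x"]
    by simp
qed

section \<open>Exponential and logarithm\<close>

text \<open>Resolves the definite description: any one decomposition may be used to evaluate the
  exponential. Multiplying by \<open>transpose V\<close> keeps the span and leaves two summands, a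
  right function with \<open>cos\<close> and a left function with \<open>sin\<close>, both
  independent of the decomposition.\<close>

lemma gr_exp_eq:
  fixes Y \<Delta> U :: "real^'r^'m"
  assumes svd: "thin_svd \<Delta> U \<theta> V"
  shows "gr_exp Y \<Delta> = col_span (Y ** V ** diag_mat (\<lambda>i. cos (\<theta> i)) + U ** diag_mat (\<lambda>i. sin (\<theta> i)))"
proof -
  let ?E = "\<lambda>U \<theta> V. Y ** V ** diag_mat (\<lambda>i. cos (\<theta> i)) + U ** diag_mat (\<lambda>i. sin (\<theta> i))"
  have rot: "col_span (?E U \<theta> V) = col_span (Y ** (V ** diag_mat (\<lambda>i. cos (\<theta> i)) ** transpose V)
      + U ** diag_mat (\<lambda>i. sin (\<theta> i)) ** transpose V)"
    if "thin_svd \<Delta> U \<theta> V" for U \<theta> V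
  proof -
    have "invertible (transpose V)"
      using that by (simp add: thin_svd_def orthogonal_matrix_invertible orthogonal_matrix_transpose)
    then have "col_span (?E U \<theta> V) = col_span (?E U \<theta> V ** transpose V)"
      by (simp add: col_span_mult_invertible)
    then show ?thesis
      by (simp add: matrix_add_rdistrib matrix_mul_assoc)
  qed
  have uniq: "col_span (?E U' \<theta>' V') = col_span (?E U \<theta> V)" if "thin_svd \<Delta> U' \<theta>' V'" for U' \<theta>' V'
    unfolding rot[OF that] rot[OF svd]
    using thin_svd_right_function[OF that svd, of cos] thin_svd_left_function[OF that svd, of sin]
    by simp
  show ?thesis
    unfolding gr_exp_def
  proof (rule the_equality)
    show "\<exists>U' \<theta>' V'. thin_svd \<Delta> U' \<theta>' V' \<and> col_span (?E U \<theta> V) = col_span (?E U' \<theta>' V')"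
      by (intro exI conjI) (rule svd refl)+
  next
    fix C
    assume "\<exists>U' \<theta>' V'. thin_svd \<Delta> U' \<theta>' V' \<and> C = col_span (?E U' \<theta>' V')"
    then show "C = col_span (?E U \<theta> V)"
      by (elim exE conjE) (simp only: uniq)
  qed
qed

lemma gr_exp_0:
  fixes Y :: "real^'r^'m"
  assumes "represents Y A"
  shows "gr_exp Y 0 = A"
proof -
  \<comment> \<open>With all singular values zero, any matrix with orthonormal columns serves as
    \<open>U\<close>; \<open>Y\<close> is at hand.\<close>
  have "thin_svd 0 Y (\<lambda>_. 0) (mat 1)"
    using assms by (simp add: thin_svd_def represents_def diag_mat_0 orthogonal_matrix_id)
  from gr_exp_eq[OF this, of Y] show ?thesis
    using assms by (simp add: represents_def diag_mat_0 diag_mat_1)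
qed

text \<open>Two choices must be shown harmless. Another representative \<open>Y1 ** R\<close> of
  \<open>B\<close> yields the same matrix to be decomposed, since \<open>R\<close> cancels against
  the inverse; another decomposition yields the same left function, as \<open>arctan\<close>
  vanishes at 0.\<close>

lemma gr_log_eq:
  fixes Y Y1 U :: "real^'r^'m"
  assumes Y1: "represents Y1 B" and inv: "invertible (transpose Y ** Y1)"
    and svd: "thin_svd (Y1 ** matrix_inv (transpose Y ** Y1) - Y) U \<sigma> V"
  shows "gr_log Y B = U ** diag_mat (\<lambda>i. arctan (\<sigma> i)) ** transpose V"
  unfolding gr_log_def
proof (rule the_equality)
  show "\<exists>(Y1 :: real^'r^'m) U' \<sigma>' V'. represents Y1 B \<and>
     thin_svd (Y1 ** matrix_inv (transpose Y ** Y1) - Y) U' \<sigma>' V' \<and>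
     U ** diag_mat (\<lambda>i. arctan (\<sigma> i)) ** transpose V = U' ** diag_mat (\<lambda>i. arctan (\<sigma>' i)) ** transpose V'"
    by (intro exI conjI) (rule Y1 svd refl)+
next
  fix \<Delta>
  assume "\<exists>(Y2 :: real^'r^'m) U' \<sigma>' V'. represents Y2 B \<and>
     thin_svd (Y2 ** matrix_inv (transpose Y ** Y2) - Y) U' \<sigma>' V' \<and>
     \<Delta> = U' ** diag_mat (\<lambda>i. arctan (\<sigma>' i)) ** transpose V'"
  then obtain Y2 :: "real^'r^'m" and U' \<sigma>' V' where Y2: "represents Y2 B"
    and svd': "thin_svd (Y2 ** matrix_inv (transpose Y ** Y2) - Y) U' \<sigma>' V'"
    and \<Delta>: "\<Delta> = U' ** diag_mat (\<lambda>i. arctan (\<sigma>' i)) ** transpose V'"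
    by blast
  obtain R where R: "orthogonal_matrix R" "Y2 = Y1 ** R"
    using represents_change_basis[OF Y1 Y2] by blast
  let ?N = "transpose Y ** Y1"
  have eq: "transpose Y ** Y2 = ?N ** R"
    by (simp add: R(2) matrix_mul_assoc)
  have "?N ** (R ** matrix_inv (?N ** R)) = mat 1"
    using invertible_mult[OF inv orthogonal_matrix_invertible[OF R(1)]]
    by (simp add: matrix_mul_assoc matrix_inv_inverse)
  then have "R ** matrix_inv (?N ** R) = matrix_inv ?N"
    by (rule matrix_inv_unique)
  then have "Y2 ** matrix_inv (transpose Y ** Y2) = Y1 ** matrix_inv ?N"
    unfolding eq R(2) by (simp flip: matrix_mul_assoc)
  with svd' have "thin_svd (Y1 ** matrix_inv ?N - Y) U' \<sigma>' V'"
    by simp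
  from thin_svd_left_function[OF this svd, of arctan]
  show "\<Delta> = U ** diag_mat (\<lambda>i. arctan (\<sigma> i)) ** transpose V"
    by (simp add: \<Delta>)
qed

lemma gr_log_self:
  fixes Y :: "real^'r^'m"
  assumes "represents Y A"
  shows "gr_log Y A = 0"
proof -
  have YY: "transpose Y ** Y = mat 1"
    using assms by (simp add: represents_def)
  have inv: "matrix_inv (mat 1 :: real^'r^'r) = mat 1"
    by (metis matrix_inv_unique matrix_mul_lid)
  have svd: "thin_svd (Y ** matrix_inv (transpose Y ** Y) - Y) Y (\<lambda>_. 0) (mat 1)"
    by (simp add: thin_svd_def YY inv diag_mat_0 orthogonal_matrix_id)
  have "invertible (transpose Y ** Y)"
    unfolding YY by (auto simp: invertible_right_inverse)
  from gr_log_eq[OF assms this svd] show ?thesis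
    by (simp add: diag_mat_0)
qed

lemma gr_exp_log:
  fixes Y Y1 :: "real^'r^'m"
  assumes card: "CARD('r) \<le> CARD('m)" and Y1: "represents Y1 B"
    and inv: "invertible (transpose Y ** Y1)"
  shows "gr_exp Y (gr_log Y B) = B"
proof -
  let ?N = "transpose Y ** Y1"
  obtain U \<sigma> V where svd: "thin_svd (Y1 ** matrix_inv ?N - Y) U \<sigma> V"
    by (rule thin_svd_exists[OF card])
  define c s where "c = diag_mat (\<lambda>i. cos (arctan (\<sigma> i)))" and "s = diag_mat (\<lambda>i. sin (arctan (\<sigma> i)))"
  have V: "orthogonal_matrix V" and M: "Y1 ** matrix_inv ?N - Y = U ** diag_mat \<sigma> ** transpose V"
    using svd by (auto simp: thin_svd_def)
  have "(Y1 ** matrix_inv ?N - Y) ** V = U ** diag_mat \<sigma>"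
    unfolding M using V by (simp add: orthogonal_matrix_def flip: matrix_mul_assoc)
  then have U\<sigma>: "Y ** V + U ** diag_mat \<sigma> = Y1 ** (matrix_inv ?N ** V)"
    using matrix_add_rdistrib[of "Y1 ** matrix_inv ?N - Y" Y V] by (simp add: matrix_mul_assoc add.commute)
  \<comment> \<open>This is \<open>tan x * cos x = sin x\<close> at
    \<open>x = arctan (\<sigma> i)\<close>; it lets the cosine factor be pulled out on the
    right.\<close>
  have "\<sigma> i * cos (arctan (\<sigma> i)) = sin (arctan (\<sigma> i))" for i
    by (simp add: cos_arctan sin_arctan)
  then have "s = diag_mat \<sigma> ** c"
    by (simp add: s_def c_def diag_mat_mult)
  then have "Y ** V ** c + U ** s = Y1 ** (matrix_inv ?N ** V ** c)"
    using U\<sigma> by (metis matrix_add_rdistrib matrix_mul_assoc)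
  moreover have "invertible (matrix_inv ?N)"
    using matrix_inv_inverse[OF inv] unfolding invertible_def by blast
  \<comment> \<open>\<open>cos\<close> is nonzero at every value of \<open>arctan\<close>, so the
    factor to the right of \<open>Y1\<close> does not change the span.\<close>
  then have "invertible (matrix_inv ?N ** V ** c)"
    using V by (simp add: c_def invertible_mult orthogonal_matrix_invertible invertible_diag_mat)
  ultimately have "col_span (Y ** V ** c + U ** s) = B"
    using Y1 by (simp add: col_span_mult_invertible represents_def)
  \<comment> \<open>Since \<open>arctan\<close> preserves nonnegativity, the formula for the
    logarithm is itself a thin decomposition, ready for the exponential.\<close>
  moreover have "thin_svd (gr_log Y B) U (\<lambda>i. arctan (\<sigma> i)) V"
    using svd gr_log_eq[OF Y1 inv svd] by (simp add: thin_svd_def)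
  then have "gr_exp Y (gr_log Y B) = col_span (Y ** V ** c + U ** s)"
    unfolding c_def s_def by (rule gr_exp_eq)
  ultimately show ?thesis
    by simp
qed

section \<open>Endpoint values of GLERP\<close>

text \<open>One representative gives existence, and a value common to all representatives gives
  uniqueness. In the three evaluations below that value is visibly free of \<open>Y\<close>, so no
  general invariance under change of representative has to be proved.\<close>

lemma glerp_eqI:
  fixes Y :: "real^'r^'m"
  assumes "represents Y A" and "\<And>Y :: real^'r^'m. represents Y A \<Longrightarrow> gr_exp Y (\<mu> *\<^sub>R gr_log Y B) = C"
  shows "glerp TYPE('r) A B \<mu> = C"
  unfolding glerp_def
proof (rule the_equality)
  show "\<exists>Y :: real^'r^'m. represents Y A \<and> C = gr_exp Y (\<mu> *\<^sub>R gr_log Y B)"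
    using assms(1) assms(2)[OF assms(1)] by metis
next
  fix D
  assume "\<exists>Y :: real^'r^'m. represents Y A \<and> D = gr_exp Y (\<mu> *\<^sub>R gr_log Y B)"
  then show "D = C"
    using assms(2) by metis
qed

lemma glerp_0:
  assumes "A \<in> grassmannian TYPE('r::finite)"
  shows "glerp TYPE('r) A B 0 = A"
proof -
  obtain Y :: "real^'r^'a" where "represents Y A"
    using grassmannian_represents[OF assms] .
  then show ?thesis
    by (rule glerp_eqI) (simp add: gr_exp_0)
qed

lemma glerp_self:
  assumes "A \<in> grassmannian TYPE('r::finite)"
  shows "glerp TYPE('r) A A \<mu> = A"
proof -
  obtain Y :: "real^'r^'a" where "represents Y A"
    using grassmannian_represents[OF assms] .
  then show ?thesis
    by (rule glerp_eqI) (simp add: gr_exp_0 gr_log_self)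
qed

text \<open>Angles below \<open>pi / 2\<close> have nonzero cosines, so
  \<open>transpose Y0 ** Y1\<close> is a product of invertible factors and the logarithm can be
  evaluated.\<close>

lemma glerp_1:
  fixes A B :: "(real^'m) set"
  assumes card: "CARD('r::finite) \<le> CARD('m)" and wd: "glerp_well_defined TYPE('r) A B"
  shows "glerp TYPE('r) A B 1 = B"
proof -
  obtain \<theta> :: "'r \<Rightarrow> real" and Y0 Y1 :: "real^'r^'m" and P Q where
    \<theta>: "\<And>j. 0 \<le> \<theta> j" "\<And>j. \<theta> j < pi / 2" and Y0: "represents Y0 A" and Y1: "represents Y1 B"
    and svd: "thin_svd (transpose Y0 ** Y1) P (\<lambda>j. cos (\<theta> j)) Q"
    using wd unfolding glerp_well_defined_def principal_angles_def by metis
  have "cos (\<theta> j) \<noteq> 0" for j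
    using cos_gt_zero_pi[of "\<theta> j"] \<theta>[of j] by (smt (verit) pi_gt_zero divide_pos_pos)
  \<comment> \<open>\<open>P\<close> is square, so orthonormal columns already make it
    orthogonal.\<close>
  moreover have "orthogonal_matrix P"
    using svd by (simp add: thin_svd_def orthogonal_matrix)
  moreover have "orthogonal_matrix (transpose Q)" and "transpose Y0 ** Y1 = P ** diag_mat (\<lambda>j. cos (\<theta> j)) ** transpose Q"
    using svd by (auto simp: thin_svd_def orthogonal_matrix_transpose)
  ultimately have inv: "invertible (transpose Y0 ** Y1)"
    by (simp add: invertible_mult orthogonal_matrix_invertible invertible_diag_mat)
  show ?thesis
  proof (rule glerp_eqI[OF Y0])
    fix Y :: "real^'r^'m"
    assume "represents Y A"
    then obtain R where R: "orthogonal_matrix R" "Y = Y0 ** R"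
      using represents_change_basis[OF Y0] by blast
    \<comment> \<open>The angles provide invertibility for the particular \<open>Y0\<close> only; an
      orthogonal factor carries it over to every representative of \<open>A\<close>.\<close>
    have "transpose Y ** Y1 = transpose R ** (transpose Y0 ** Y1)"
      by (simp add: R(2) matrix_transpose_mul matrix_mul_assoc)
    moreover have "invertible (transpose R)"
      using R(1) by (simp add: orthogonal_matrix_invertible orthogonal_matrix_transpose)
    ultimately have "invertible (transpose Y ** Y1)"
      using inv by (simp add: invertible_mult)
    then show "gr_exp Y (1 *\<^sub>R gr_log Y B) = B"
      using gr_exp_log[OF card Y1] by simp
  qed
qed

section \<open>Interpolation\<close>

text \<open>The claim covers every window of indices from \<open>j\<close> to \<open>j + k\<close>
  containing \<open>i\<close>, because the recursion combines two shorter windows. Of the nodes it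
  uses only that they are distinct.\<close>

lemma gider_step_node:
  fixes Y :: "nat \<Rightarrow> (real^'m) set"
  assumes card: "CARD('r::finite) \<le> CARD('m)"
    and inj: "inj_on t {..n}"
    and Y: "\<And>j. j \<le> n \<Longrightarrow> Y j \<in> grassmannian TYPE('r)"
    and wd: "gider_well_defined TYPE('r) n t Y (t i)"
    and "j + k \<le> n" "j \<le> i" "i \<le> j + k"
  shows "gider_step TYPE('r) t Y (t i) k j = Y i"
  using assms(5-7)
proof (induction k arbitrary: j)
  case 0
  then show ?case by simp
next
  case (Suc k)
  let ?S = "gider_step TYPE('r) t Y (t i) k"
  let ?\<mu> = "(t i - t j) / (t (j + Suc k) - t j)"
  have step: "gider_step TYPE('r) t Y (t i) (Suc k) j = glerp TYPE('r) (?S j) (?S (Suc j)) ?\<mu>"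
    by simp
  have Yi: "Y i \<in> grassmannian TYPE('r)"
    using Y Suc.prems by simp
  consider "i = j" | "j < i" "i < j + Suc k" | "i = j + Suc k"
    using Suc.prems by linarith
  then show ?case
  proof cases
    case 1
    then have "?S j = Y i" using Suc.IH[of j] Suc.prems by simp
    \<comment> \<open>The numerator of the parameter is zero here.\<close>
    then show ?thesis unfolding step using 1 Yi by (simp add: glerp_0)
  next
    case 2
    then have "?S j = Y i" "?S (Suc j) = Y i"
      using Suc.IH[of j] Suc.IH[of "Suc j"] Suc.prems by simp_all
    then show ?thesis unfolding step using Yi by (simp add: glerp_self)
  next
    case 3
    then have B: "?S (Suc j) = Y i"
      using Suc.IH[of "Suc j"] Suc.prems by simp
    \<comment> \<open>The parameter is a quotient of equal numbers; it is 1 only because they are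
      nonzero, as division by zero would give 0.\<close>
    have "t i \<noteq> t j"
      using inj_onD[OF inj, of i j] 3 Suc.prems by auto
    then have "?\<mu> = 1"
      using 3 by simp
    \<comment> \<open>The well-definedness condition at level \<open>Suc k\<close> concerns the
      arguments at level \<open>k\<close>, which are the ones combined here.\<close>
    moreover have "Suc k \<in> {1..n}" "j \<in> {0..n - Suc k}"
      using Suc.prems by auto
    then have "glerp_well_defined TYPE('r) (?S j) (?S (Suc j))"
      using wd unfolding gider_well_defined_def by fastforce
    ultimately show ?thesis
      unfolding step using B glerp_1[OF card] by metis
  qed
qed

theorem proposition4p4:
  fixes n :: nat and h :: real and t :: "nat \<Rightarrow> real"
    and Y :: "nat \<Rightarrow> (real^'m) set"
  assumes "CARD('r::finite) \<le> CARD('m)"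
    and "n \<ge> 1"
    and "h > 0"
    and "\<And>j. j \<le> n \<Longrightarrow> t j = t 0 + real j * h"
    and "\<And>j. j \<le> n \<Longrightarrow> Y j \<in> grassmannian TYPE('r)"
    and "\<And>s. s \<in> {t 0..t n} \<Longrightarrow> gider_well_defined TYPE('r) n t Y s"
  shows "\<forall>j\<le>n. gider TYPE('r) n t Y (t j) = Y j"
proof (intro allI impI)
  fix j assume j: "j \<le> n"
  have inj: "inj_on t {..n}"
  proof (rule inj_onI)
    fix a b assume "a \<in> {..n}" "b \<in> {..n}" "t a = t b"
    then have "real a * h = real b * h"
      using assms(4)[of a] assms(4)[of b] by simp
    then show "a = b" using assms(3) by simp
  qed
  \<comment> \<open>Well-definedness is assumed for parameters in this interval only.\<close>
  have "t j \<in> {t 0..t n}"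
    using assms(3) assms(4)[OF j] assms(4)[of n] j by (simp add: mult_right_mono)
  from gider_step_node[OF assms(1) inj assms(5) assms(6)[OF this], of 0 n] j
  show "gider TYPE('r) n t Y (t j) = Y j"
    by (simp add: gider_def)
qed

end
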